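(* Let $n$ be a positive integer with $n\ne 1$ and $n\ne 3$. There exists a universal cycle for the set of illegal rankings of length $n$ over the alphabet $[n]=\{1,\dots,n\}$, i.e., the set of $n$-letter words over $[n]$ that are not legal rankings.
   Context: A word $a_1a_2\dots a_n$ over $[n]=\{1,\dots,n\}$ represents a ranking (possibly with ties) of $n$ contestants, $a_j$ being the place of contestant $j$. It is a legal ranking if for every letter $r$ occurring in the word, the number of indices $j$ with $a_j<r$ equals $r-1$ (e.g., $1413$ is legal, while $254313$ and $22$ are illegal; in particular every legal ranking contains a $1$). An illegal ranking is a word over $[n]$ of length $n$ that is not a legal ranking. For a set $\mathcal{C}$ of $n$-letter words over an alphabet, a universal cycle (U-cycle) for $\mathcal{C}$ is a cyclic sequence $x_1x_2\dots x_N$ with $N=|\mathcal{C}|$ such that the $N$ words $x_ix_{i+1}\dots x_{i+n-1}$ ($1\le i\le N$, indices taken modulo $N$) are exactly the words of $\mathcal{C}$, each occurring exactly once. *)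

theory Defs
  imports Main
begin

definition words :: "nat \<Rightarrow> nat list set" where
  "words n = {w. length w = n \<and> set w \<subseteq> {1..n}}"

(* The subtraction never truncates: letters of a word over {1..n} are positive. *)
definition legal_rankings :: "nat \<Rightarrow> nat list set" where
  "legal_rankings n =
     {w \<in> words n. \<forall>r \<in> set w. card {j. j < n \<and> w ! j < r} = r - 1}"

definition illegal_rankings :: "nat \<Rightarrow> nat list set" where
  "illegal_rankings n = words n - legal_rankings n"

(* The window may be longer than xs, in which case it wraps around repeatedly. *)
definition cyclic_window :: "'a list \<Rightarrow> nat \<Rightarrow> nat \<Rightarrow> 'a list" where
  "cyclic_window xs n i = map (\<lambda>k. xs ! ((i + k) mod length xs)) [0..<n]"

definition universal_cycle :: "nat \<Rightarrow> 'a list set \<Rightarrow> 'a list \<Rightarrow> bool" where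
  "universal_cycle n C xs \<longleftrightarrow>
     length xs = card C \<and> bij_betw (cyclic_window xs n) {..<length xs} C"

end

theory Submission
  imports Defs "HOL-Library.Multiset" "Graph_Theory.Euler"
begin

text \<open>
  A universal cycle is an Euler circuit of the digraph whose arcs are the illegal words \<open>w\<close>,
  leading from the prefix to the suffix of \<open>w\<close> of length \<open>n - 1\<close>. Rotation preserves illegality,
  so this graph is balanced, and only connectivity needs work. Rotation also allows any single
  letter to be exchanged as long as the resulting multiset is illegal, so it suffices to lead every
  illegal multiset to the constant word \<open>n \<dots> n\<close> by such exchanges. Once no \<open>1\<close> is left, everything
  is illegal. With \<open>k\<close> letters \<open>1\<close>, one of them can be replaced by \<open>2\<close> if \<open>k \<ge> 3\<close>, and by \<open>n\<close> if
  \<open>k = 1\<close>, or if \<open>k = 2\<close> and there is no \<open>2\<close>. The remaining multisets \<open>{1, 1, 2, x, \<dots>}\<close> lead through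
  \<open>{1, 1, 2, 2, \<dots>}\<close> to \<open>{1, 2, 2, 3, \<dots>}\<close>; the existence of the fourth letter is where \<open>n \<ge> 4\<close> is
  needed.
\<close>

section \<open>Universal cycles from Euler circuits\<close>

text \<open>Subgraph of a de Bruijn graph. Only prefixes and suffixes that occur are vertices, as an
  isolated vertex would spoil connectedness.\<close>

definition word_graph :: "'a list set \<Rightarrow> ('a list, 'a list) pre_digraph" where
  "word_graph C = \<lparr>verts = butlast ` C \<union> tl ` C, arcs = C, tail = butlast, head = tl\<rparr>"

lemma word_graph_simps [simp]:
  "verts (word_graph C) = butlast ` C \<union> tl ` C"
  "arcs (word_graph C) = C"
  "tail (word_graph C) = butlast"
  "head (word_graph C) = tl"
  by (simp_all add: word_graph_def)

text \<open>Consecutive arcs of \<open>word_graph C\<close>: paths run through whole words, on which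
  illegality is defined, rather than through vertices.\<close>

definition shift_rel :: "'a list set \<Rightarrow> ('a list \<times> 'a list) set" where
  "shift_rel C = {(u, v). u \<in> C \<and> v \<in> C \<and> tl u = butlast v}"

lemma butlast_rotate1: "butlast (rotate1 w) = tl w"
  by (cases w) auto

lemma mset_rotate1: "mset (rotate1 w) = mset w"
  by (cases w) auto

lemma fin_digraph_word_graph:
  assumes "finite C"
  shows "fin_digraph (word_graph C)"
  using assms by unfold_locales auto

lemma rotate1_image_eq:
  assumes "finite C" and "rotate1 ` C \<subseteq> C"
  shows "rotate1 ` C = C"
  using endo_inj_surj[OF assms] inj_on_subset[OF inj_rotate1 subset_UNIV] .

text \<open>Rotation turns each arc into \<open>u\<close> into an arc out of \<open>u\<close>;
  finiteness makes this a bijection.\<close>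

lemma word_graph_balanced:
  assumes "finite C" and "rotate1 ` C \<subseteq> C"
  shows "in_degree (word_graph C) u = out_degree (word_graph C) u"
proof -
  have "out_arcs (word_graph C) u = rotate1 ` in_arcs (word_graph C) u"
    using rotate1_image_eq[OF assms]
    by (force simp: in_arcs_def out_arcs_def butlast_rotate1)
  then show ?thesis
    by (simp add: in_degree_def out_degree_def card_image inj_on_subset[OF inj_rotate1])
qed

text \<open>Prefixes turn a shift path into a directed walk. Symmetrising makes walks reversible, so
  one common target \<open>t\<close> suffices.\<close>

lemma word_graph_connected:
  assumes "finite C" and "rotate1 ` C \<subseteq> C"
    and "t \<in> C" and sink: "\<And>w. w \<in> C \<Longrightarrow> (w, t) \<in> (shift_rel C)\<^sup>*"
  shows "connected (word_graph C)"
proof -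
  let ?G = "word_graph C"
  interpret fin_digraph ?G
    using assms(1) by (rule fin_digraph_word_graph)
  have walk: "butlast w \<rightarrow>\<^sup>*\<^bsub>?G\<^esub> butlast v" if "(w, v) \<in> (shift_rel C)\<^sup>*" "w \<in> C" for w v
    using that
  proof (induction rule: rtrancl_induct)
    case base
    then show ?case by auto
  next
    case (step u v)
    then have "(butlast u, butlast v) \<in> arcs_ends ?G"
      by (auto simp: shift_rel_def arcs_ends_conv)
    with step show ?case
      by (meson reachable_adj_trans)
  qed
  have to_t: "u \<rightarrow>\<^sup>*\<^bsub>mk_symmetric ?G\<^esub> butlast t" if "u \<in> verts ?G" for u
  proof -
    \<comment> \<open>A suffix is the prefix of the rotated word, so every vertex is a
      prefix.\<close>
    have "\<exists>w \<in> C. u = butlast w"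
      using that assms(2) by (auto simp: butlast_rotate1[symmetric])
    then show ?thesis
      using walk sink reachable_mk_symmetricI by blast
  qed
  have "symmetric (mk_symmetric ?G)"
    by (rule symmetric_mk_symmetric)
  then have from_t: "butlast t \<rightarrow>\<^sup>*\<^bsub>mk_symmetric ?G\<^esub> u" if "u \<in> verts ?G" for u
    using to_t[OF that] by (rule symmetric_reachable)
  show ?thesis
    unfolding connected_def
  proof (rule strongly_connectedI)
    show "verts (mk_symmetric ?G) \<noteq> {}"
      using assms(3) by auto
    interpret S: pair_wf_digraph "mk_symmetric ?G" ..
    show "u \<rightarrow>\<^sup>*\<^bsub>mk_symmetric ?G\<^esub> v"
      if "u \<in> verts (mk_symmetric ?G)" "v \<in> verts (mk_symmetric ?G)" for u v
      using that to_t[of u] from_t[of v] by (auto intro: S.reachable_trans)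
  qed
qed

section \<open>Reading a cyclic word off a closed walk\<close>

lemma (in pre_digraph) cas_nth:
  assumes "cas u p v" and "Suc i < length p"
  shows "head G (p ! i) = tail G (p ! Suc i)"
  using assms
proof (induction p arbitrary: u i)
  case (Cons e p)
  then show ?case
    by (cases p; cases i) auto
qed simp

lemma (in pre_digraph) cas_nth_mod:
  assumes "cas u p u" and "i < length p"
  shows "head G (p ! i) = tail G (p ! (Suc i mod length p))"
proof (cases "Suc i = length p")
  case True
  have "tail G (hd p) = u"
    using assms by (cases p) auto
  moreover have "head G (last p) = w" if "cas v p w" "p \<noteq> []" for v w
    using that by (induction p arbitrary: v) (auto split: if_splits)
  then have "head G (last p) = u"
    using assms by (metis gr_implies_not0 list.size(3))
  ultimately show ?thesis
    using True assms(2) by (metis diff_Suc_1 hd_conv_nth last_conv_nth length_0_conv mod_self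
        not_less_zero)
next
  case False
  then show ?thesis
    using cas_nth[OF assms(1)] assms(2) by simp
qed

lemma cyclic_window_map_hd:
  assumes len: "\<And>w. w \<in> set p \<Longrightarrow> length w = n"
    and overlap: "\<And>i. i < length p \<Longrightarrow> tl (p ! i) = butlast (p ! (Suc i mod length p))"
    and "i < length p"
  shows "cyclic_window (map hd p) n i = p ! i"
proof -
  have pos: "0 < length p"
    using assms(3) by linarith
  have len_nth: "length (p ! (j mod length p)) = n" for j
    using len pos by simp
  \<comment> \<open>The index \<open>i\<close> is reduced modulo the length, so the induction on
    \<open>k\<close> may pass to \<open>Suc i\<close> beyond the end of \<open>p\<close>.\<close>
  have *: "hd (p ! ((i + k) mod length p)) = p ! (i mod length p) ! k" if "k < n" for i k
    using that
  proof (induction k arbitrary: i)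
    case 0
    then show ?case
      using len_nth[of i] by (metis add.right_neutral hd_conv_nth length_0_conv less_irrefl)
  next
    case (Suc k)
    have "p ! (i mod length p) ! Suc k = tl (p ! (i mod length p)) ! k"
      using Suc.prems len_nth[of i] by (simp add: nth_tl)
    also have "\<dots> = butlast (p ! (Suc i mod length p)) ! k"
      using overlap[of "i mod length p"] pos by (simp add: mod_Suc_eq)
    also have "\<dots> = p ! (Suc i mod length p) ! k"
      using Suc.prems len_nth[of "Suc i"] by (simp add: nth_butlast)
    finally show ?case
      using Suc.IH[of "Suc i"] Suc.prems by simp
  qed
  show ?thesis
    using *[of _ i] len_nth[of i] assms(3) mod_less_divisor[OF pos]
    by (auto intro!: nth_equalityI simp: cyclic_window_def)
qed

text \<open>The first letters of the arcs along an Euler circuit form the cycle.\<close>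

theorem universal_cycle_exists:
  assumes "finite C" and "rotate1 ` C \<subseteq> C" and len: "\<And>w. w \<in> C \<Longrightarrow> length w = n"
    and "t \<in> C" and "\<And>w. w \<in> C \<Longrightarrow> (w, t) \<in> (shift_rel C)\<^sup>*"
  shows "\<exists>xs. universal_cycle n C xs"
proof -
  let ?G = "word_graph C"
  interpret fin_digraph ?G
    using assms(1) by (rule fin_digraph_word_graph)
  have "connected ?G"
    using assms by (intro word_graph_connected)
  then obtain u p where "euler_trail u p u"
    using closed_euler1 word_graph_balanced[OF assms(1,2)] by blast
  then have p: "distinct p" "set p = C" "cas u p u"
    by (auto simp: euler_trail_def trail_def awalk_def)
  have window: "cyclic_window (map hd p) n i = p ! i" if "i < length p" for i
    using cas_nth_mod[OF p(3)] len p(2) that by (intro cyclic_window_map_hd) auto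
  have "bij_betw (cyclic_window (map hd p) n) {..<length p} C \<longleftrightarrow> bij_betw ((!) p) {..<length p} C"
    using window by (intro bij_betw_cong) auto
  then have "universal_cycle n C (map hd p)"
    using p by (auto simp: universal_cycle_def distinct_card bij_betw_nth)
  then show ?thesis ..
qed

section \<open>Illegality depends only on the multiset of letters\<close>

definition illegal_mset :: "nat \<Rightarrow> nat multiset \<Rightarrow> bool" where
  "illegal_mset n M \<longleftrightarrow> size M = n \<and> set_mset M \<subseteq> {1..n} \<and>
     (\<exists>r \<in># M. size {#x \<in># M. x < r#} \<noteq> r - 1)"

lemma illegal_rankings_iff: "w \<in> illegal_rankings n \<longleftrightarrow> illegal_mset n (mset w)"
proof -
  have "card {j. j < length w \<and> w ! j < r} = size {#x \<in># mset w. x < r#}" for r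
    by (simp add: length_filter_conv_card flip: mset_filter)
  then show ?thesis
    by (auto simp: illegal_rankings_def legal_rankings_def words_def illegal_mset_def)
qed

lemma finite_illegal_rankings: "finite (illegal_rankings n)"
proof (rule finite_subset)
  show "illegal_rankings n \<subseteq> {w. set w \<subseteq> {1..n} \<and> length w = n}"
    by (auto simp: illegal_rankings_def words_def)
qed (simp add: finite_lists_length_eq)

lemma rotate_illegal:
  assumes "w \<in> illegal_rankings n"
  shows "(w, rotate k w) \<in> (shift_rel (illegal_rankings n))\<^sup>*"
proof (induction k)
  case (Suc k)
  have "mset (rotate k w) = mset w"
    by (induction k) (auto simp: mset_rotate1)
  then have "(rotate k w, rotate (Suc k) w) \<in> shift_rel (illegal_rankings n)"
    using assms unfolding shift_rel_def
    by (simp add: illegal_rankings_iff butlast_rotate1 mset_rotate1)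
  with Suc show ?case
    by (rule rtrancl_into_rtrancl)
qed simp

text \<open>A letter can be exchanged at the moment when rotation has brought it to the front.\<close>

lemma replace_letter:
  assumes "w \<in> illegal_rankings n" and "mset w = add_mset x M" and "illegal_mset n (add_mset b M)"
  shows "\<exists>v \<in> illegal_rankings n. mset v = add_mset b M \<and>
    (w, v) \<in> (shift_rel (illegal_rankings n))\<^sup>*"
proof -
  have "x \<in> set w"
    using assms(2) by (metis set_mset_mset union_single_eq_member)
  then obtain ys zs where w: "w = ys @ x # zs"
    by (meson split_list)
  have M: "M = mset (zs @ ys)"
    using assms(2) w by (simp add: union_commute)
  have "(w, x # zs @ ys) \<in> (shift_rel (illegal_rankings n))\<^sup>*"
    using rotate_illegal[OF assms(1), of "length ys"] w by (simp add: rotate_append)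
  moreover have "(x # zs @ ys, zs @ ys @ [b]) \<in> shift_rel (illegal_rankings n)"
    using assms M
    by (simp add: shift_rel_def illegal_rankings_iff butlast_append union_commute)
  ultimately show ?thesis
    using assms(3) M by (intro bexI[of _ "zs @ ys @ [b]"]) (auto simp: illegal_rankings_iff)
qed

section \<open>Reaching the constant word\<close>

text \<open>Exactly the ones lie below the least letter \<open>r\<close> other than 1, so legality
  would force \<open>r\<close> to be \<open>Suc (count M 1)\<close>.\<close>

lemma illegal_msetI_second_place:
  assumes "size M = n" and "set_mset M \<subseteq> {1..n}" and "x \<in># M" and "x \<noteq> 1"
    and "Suc (count M 1) \<notin># M"
  shows "illegal_mset n M"
proof -
  define r where "r = Min (set_mset M - {1})"
  have r: "r \<in> set_mset M - {1}"
    unfolding r_def using assms by (intro Min_in) auto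
  have "r \<le> y" if "y \<in># M" "y \<noteq> 1" for y
    unfolding r_def using that by (intro Min_le) auto
  moreover have "r > 1"
    using r assms(2) by force
  ultimately have "{#y \<in># M. y < r#} = {#y \<in># M. y = 1#}"
    by (intro filter_mset_cong) (auto simp: not_le[symmetric])
  then have "size {#y \<in># M. y < r#} = count M 1"
    by (simp add: filter_eq_replicate_mset)
  moreover have "count M 1 \<noteq> r - 1"
    using r assms(5) \<open>r > 1\<close> by auto
  ultimately have "size {#y \<in># M. y < r#} \<noteq> r - 1"
    by simp
  with r assms(1,2) show ?thesis
    unfolding illegal_mset_def by blast
qed

text \<open>Only ones lie below 2, so legality would force exactly one of them.\<close>

lemma illegal_msetI_two:
  assumes "size M = n" and "set_mset M \<subseteq> {1..n}" and "2 \<in># M" and "count M 1 \<noteq> 1"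
  shows "illegal_mset n M"
proof -
  have "{#y \<in># M. y < 2#} = {#y \<in># M. y = 1#}"
    using assms(2) by (intro filter_mset_cong) force+
  then have "size {#y \<in># M. y < 2#} \<noteq> 2 - 1"
    using assms(4) by (simp add: filter_eq_replicate_mset)
  with assms(1-3) show ?thesis
    unfolding illegal_mset_def by blast
qed

text \<open>Letters other than \<open>n\<close> are exchanged for \<open>n\<close> one at a
  time.\<close>

lemma reach_const_if_no_one:
  assumes "w \<in> illegal_rankings n" and "1 \<notin> set w" and "n > 1"
  shows "(w, replicate n n) \<in> (shift_rel (illegal_rankings n))\<^sup>*"
  using assms
proof (induction "length (filter (\<lambda>x. x \<noteq> n) w)" arbitrary: w rule: less_induct)
  case less
  have w: "size (mset w) = n" "set_mset (mset w) \<subseteq> {1..n}"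
    using less.prems by (auto simp: illegal_rankings_iff illegal_mset_def)
  show ?case
  proof (cases "\<exists>x \<in> set w. x \<noteq> n")
    case True
    then obtain x where x: "x \<in># mset w" "x \<noteq> n"
      by auto
    then obtain M where M: "mset w = add_mset x M"
      by (meson mset_add)
    have "1 \<notin># M"
      using less.prems(2) M by (metis set_mset_mset union_iff add_mset_add_single)
    have "illegal_mset n (add_mset n M)"
    proof (rule illegal_msetI_second_place)
      \<comment> \<open>Without ones, the letter to be avoided is 1 itself.\<close>
      show "Suc (count (add_mset n M) 1) \<notin># add_mset n M"
        using \<open>1 \<notin># M\<close> \<open>n > 1\<close> by (simp add: not_in_iff)
    qed (use w M \<open>n > 1\<close> in auto)
    then obtain v where v: "v \<in> illegal_rankings n" "mset v = add_mset n M"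
      "(w, v) \<in> (shift_rel (illegal_rankings n))\<^sup>*"
      using replace_letter[OF less.prems(1) M] by blast
    have "1 \<notin> set v"
      using v(2) \<open>1 \<notin># M\<close> \<open>n > 1\<close> by (metis insert_iff less_irrefl set_mset_add_mset_insert
          set_mset_mset)
    moreover have "length (filter (\<lambda>x. x \<noteq> n) v) < length (filter (\<lambda>x. x \<noteq> n) w)"
      using v(2) M x(2) by (simp flip: size_mset)
    ultimately have "(v, replicate n n) \<in> (shift_rel (illegal_rankings n))\<^sup>*"
      using less.hyps v(1) \<open>n > 1\<close> by blast
    with v(3) show ?thesis
      by (rule rtrancl_trans)
  next
    case False
    then have "w = replicate n n"
      using w by (metis replicate_length_same size_mset)
    then show ?thesis
      by simp
  qed
qed

lemma fewer_ones:
  assumes "w \<in> illegal_rankings n" and "1 \<in> set w" and "n \<ge> 4"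
  shows "\<exists>v \<in> illegal_rankings n. count (mset v) 1 < count (mset w) 1 \<and>
    (w, v) \<in> (shift_rel (illegal_rankings n))\<^sup>*"
proof -
  have w: "size (mset w) = n" "set_mset (mset w) \<subseteq> {1..n}"
    using assms by (auto simp: illegal_rankings_iff illegal_mset_def)
  obtain M where M: "mset w = add_mset 1 M"
    using assms(2) by (metis mset_add set_mset_mset)
  have M': "Suc (size M) = n" "set_mset M \<subseteq> {1..n}"
    using w M by auto
  have replace_one: ?thesis if b: "b \<noteq> 1" "illegal_mset n (add_mset b M)" for b
  proof -
    obtain v where "v \<in> illegal_rankings n" "mset v = add_mset b M"
      "(w, v) \<in> (shift_rel (illegal_rankings n))\<^sup>*"
      using replace_letter[OF assms(1) M b(2)] by blast
    with b(1) M show ?thesis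
      by (intro bexI[of _ v]) auto
  qed
  \<comment> \<open>\<open>M\<close> has one 1 fewer than \<open>w\<close>: these cases are three or
    more ones in \<open>w\<close>, two with a 2, a single one, and two without a 2.\<close>
  consider "count M 1 \<ge> 2" | "count M 1 = 1" "2 \<in># M" | "count M 1 = 0" | "count M 1 = 1" "2 \<notin># M"
    by linarith
  then show ?thesis
  proof cases
    case 1
    with M' assms(3) show ?thesis
      by (intro replace_one[of 2] illegal_msetI_two) auto
  next
    case 2
    obtain K where K: "M = add_mset 1 (add_mset 2 K)"
      using 2 by (metis count_inI insert_noteq_member mset_add one_neq_zero numeral_One
          numeral_eq_iff semiring_norm(85))
    \<comment> \<open>The size of \<open>K\<close> is \<open>n - 3\<close>, which is
      positive.\<close>
    then have "K \<noteq> {#}"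
      using M' assms(3) by auto
    then obtain x N where N: "K = add_mset x N"
      by (meson multiset_cases)
    have "x \<noteq> 1"
      using 2 K N by (auto split: if_splits)
    have w': "mset w = add_mset x ({#1, 1, 2#} + N)"
      using M K N by simp
    have "illegal_mset n (add_mset 2 ({#1, 1, 2#} + N))"
      using M' K N assms(3) by (intro illegal_msetI_two) auto
    then obtain v where v: "v \<in> illegal_rankings n" "mset v = add_mset 2 ({#1, 1, 2#} + N)"
      "(w, v) \<in> (shift_rel (illegal_rankings n))\<^sup>*"
      using replace_letter[OF assms(1) w'] by blast
    \<comment> \<open>Regrouped so that a 1 is exchanged next.\<close>
    have v': "mset v = add_mset 1 ({#1, 2, 2#} + N)"
      using v(2) by simp
    have "illegal_mset n (add_mset 3 ({#1, 2, 2#} + N))"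
      unfolding illegal_mset_def
    proof (intro conjI bexI[of _ 3])
      \<comment> \<open>At least the letters 1, 2, 2 lie below 3, where legality demands exactly
        two.\<close>
      show "size {#x \<in># add_mset 3 ({#1, 2, 2#} + N). x < 3#} \<noteq> 3 - 1"
        by simp
    qed (use M' K N assms(3) in auto)
    then obtain u where u: "u \<in> illegal_rankings n" "mset u = add_mset 3 ({#1, 2, 2#} + N)"
      "(v, u) \<in> (shift_rel (illegal_rankings n))\<^sup>*"
      using replace_letter[OF v(1) v'] by blast
    moreover have "count (mset u) 1 < count (mset w) 1"
      using u(2) w' \<open>x \<noteq> 1\<close> by simp
    ultimately show ?thesis
      using v(3) by (meson rtrancl_trans)
  next
    case 3
    with M' assms(3) show ?thesis
      by (intro replace_one[of n] illegal_msetI_second_place[of _ _ n]) (auto simp: not_in_iff)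
  next
    case 4
    \<comment> \<open>One 1 remains, so the second place would be 2, which neither \<open>M\<close>
      nor the inserted \<open>n\<close> supplies.\<close>
    with M' assms(3) show ?thesis
      by (intro replace_one[of n] illegal_msetI_second_place[of _ _ n])
        (auto simp: numeral_2_eq_2)
  qed
qed

lemma reach_const:
  assumes "w \<in> illegal_rankings n" and "n \<ge> 4"
  shows "(w, replicate n n) \<in> (shift_rel (illegal_rankings n))\<^sup>*"
  using assms(1)
proof (induction "count (mset w) 1" arbitrary: w rule: less_induct)
  case less
  show ?case
  proof (cases "1 \<in> set w")
    case True
    then show ?thesis
      using fewer_ones[OF less.prems _ assms(2)] less.hyps by (meson rtrancl_trans)
  next
    case False
    then show ?thesis
      using reach_const_if_no_one less.prems assms(2) by simp
  qed
qed

section \<open>Length two and the conclusion\<close>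

lemma illegal_rankings_2: "illegal_rankings 2 = {[2, 2]}"
proof -
  have "w \<in> illegal_rankings 2 \<longleftrightarrow> w = [2, 2]" for w
  proof
    assume "w \<in> illegal_rankings 2"
    then obtain a b where "w = [a, b]" "a \<in> {1, 2}" "b \<in> {1, 2}" and
      "illegal_mset 2 (mset w)"
      by (auto simp: illegal_rankings_iff illegal_mset_def length_Suc_conv numeral_2_eq_2 le_Suc_eq)
    then show "w = [2, 2]"
      by (auto simp: illegal_mset_def)
  qed (auto simp: illegal_rankings_iff illegal_mset_def)
  then show ?thesis
    by blast
qed

theorem theorem7:
  fixes n :: nat
  assumes "0 < n" and "n \<noteq> 1" and "n \<noteq> 3"
  shows "\<exists>xs. universal_cycle n (illegal_rankings n) xs"
proof (cases "n = 2")
  case True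
  \<comment> \<open>The cycle has a single letter, and its window of length two wraps
    around.\<close>
  have "universal_cycle 2 {[2, 2]} [2]"
    by (simp add: universal_cycle_def cyclic_window_def bij_betw_def upt_rec lessThan_Suc)
  then show ?thesis
    using True illegal_rankings_2 by metis
next
  case False
  then have "n \<ge> 4"
    using assms by linarith
  show ?thesis
  proof (rule universal_cycle_exists)
    show "replicate n n \<in> illegal_rankings n"
      using \<open>n \<ge> 4\<close> unfolding illegal_rankings_iff
      by (intro illegal_msetI_second_place[of _ _ n]) auto
    show "rotate1 ` illegal_rankings n \<subseteq> illegal_rankings n"
      by (auto simp: illegal_rankings_iff mset_rotate1)
  qed (use finite_illegal_rankings reach_const \<open>n \<ge> 4\<close> in
      \<open>auto simp: illegal_rankings_def words_def\<close>)
qed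

end
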